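(* Let $T\subset\mathbb{R}^n$ be closed, $k\in\mathbb{Z}_+$, $I=\{i\in\mathbb{Z}_+^n:|i|\le 2k\}$, and let $(g_i)_{|i|\le 2k}$ be a family of real numbers with $g_0=1$. The following statements (a), (b) are equivalent. (a) There exists $f\in L^1_+(T,dt)$, with $\int_T|t^i|f(t)\,dt<\infty$ for $|i|\le 2k$, such that $$\int_T t^if(t)\,dt=g_i\qquad(|i|\le 2k).$$ (b) The function $$L(\lambda):=\sum_{|i|\le 2k}g_i\lambda_i-\int_T e^{\frac{\sum_{|i|\le 2k}\lambda_it^i}{\|t\|^{2k}+1}}\,e^{-\|t\|^2-1}\,dt\qquad(\lambda=(\lambda_i)_{|i|\le2k}\in\mathbb{R}^{\operatorname{card} I})$$ is bounded from above. In this case, $L$ attains its maximum at a point $\lambda^*=(\lambda_i^* )_{|i|\le 2k}$, and the function $$f_*(t):=\frac{1}{\|t\|^{2k}+1}\,e^{\sum_{|i|\le 2k}\lambda_i^*\frac{t^i}{\|t\|^{2k}+1}}\,e^{-\|t\|^2-1}$$ satisfies $\int_T t^if_*(t)\,dt=g_i$ for all $|i|\le 2k$.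
   Context: $\mathbb{Z}_+=\{0,1,2,\dots\}$; $dt$ is Lebesgue measure on $\mathbb{R}^n$; for $i=(i_1,\dots,i_n)\in\mathbb{Z}_+^n$, $t^i=t_1^{i_1}\cdots t_n^{i_n}$ and $|i|=i_1+\cdots+i_n$; $\|t\|=(\sum_{j=1}^n t_j^2)^{1/2}$. $L^1_+(T,dt)$ is the set of (classes of) Lebesgue integrable functions on $T$ that are $\ge0$ a.e. *)

theory Defs
  imports "HOL-Analysis.Analysis"
begin

type_synonym 'n multi_index = "'n \<Rightarrow> nat"

definition mi_degree :: "'n::finite multi_index \<Rightarrow> nat" where
  "mi_degree i = (\<Sum>j\<in>UNIV. i j)"

definition multi_indices :: "nat \<Rightarrow> 'n::finite multi_index set" where
  "multi_indices d = {i. mi_degree i \<le> d}"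

definition mi_monom :: "real ^ 'n \<Rightarrow> 'n::finite multi_index \<Rightarrow> real" where
  "mi_monom t i = (\<Prod>j\<in>UNIV. (t $ j) ^ i j)"

text \<open>Elements of \<open>L\<^sup>1\<^sub>+(T, dt)\<close> are represented by functions on the whole space,
  of which only the restriction to \<open>T\<close> matters.\<close>

definition L1_plus :: "(real ^ 'n::finite) set \<Rightarrow> (real ^ 'n \<Rightarrow> real) set" where
  "L1_plus T = {f. integrable (lebesgue_on T) f \<and> (AE t in lebesgue_on T. 0 \<le> f t)}"

text \<open>Families \<open>(\<lambda>\<^sub>i)\<close> indexed by the multi-indices of degree at most \<open>2k\<close>, encoded as
  functions that take the fixed value \<open>undefined\<close> at all other multi-indices.\<close>

definition param_space :: "nat \<Rightarrow> ('n::finite multi_index \<Rightarrow> real) set" where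
  "param_space k = multi_indices (2 * k) \<rightarrow>\<^sub>E (UNIV :: real set)"

text \<open>The quotient of \<open>\<bar>mi_monom t i\<bar>\<close> by \<open>norm t ^ (2 * k) + 1\<close> is at most 1 for
  multi-indices of degree at most \<open>2k\<close>, so the integrand below is dominated by a constant multiple
  of a Gaussian and its integral over any closed \<open>T\<close> exists.\<close>

definition dual_fun ::
  "(real ^ 'n::finite) set \<Rightarrow> nat \<Rightarrow> ('n multi_index \<Rightarrow> real) \<Rightarrow> ('n multi_index \<Rightarrow> real) \<Rightarrow> real" where
  "dual_fun T k g l =
     (\<Sum>i\<in>multi_indices (2 * k). g i * l i) -
     (\<integral>t. exp ((\<Sum>i\<in>multi_indices (2 * k). l i * mi_monom t i) / (norm t ^ (2 * k) + 1))
           * exp (- (norm t)\<^sup>2 - 1) \<partial>lebesgue_on T)"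

definition opt_density :: "nat \<Rightarrow> ('n::finite multi_index \<Rightarrow> real) \<Rightarrow> real ^ 'n \<Rightarrow> real" where
  "opt_density k l t =
     1 / (norm t ^ (2 * k) + 1)
     * exp (\<Sum>i\<in>multi_indices (2 * k). l i * (mi_monom t i / (norm t ^ (2 * k) + 1)))
     * exp (- (norm t)\<^sup>2 - 1)"

end

theory Submission
  imports Defs "HOL-Probability.Distributions" "HOL-Computational_Algebra.Polynomial"
begin

text \<open>Write \<open>u\<^sub>i t = t\<^sup>i / (norm t ^ (2 * k) + 1)\<close>, so that \<open>\<bar>u\<^sub>i\<bar> \<le> 1\<close>, and let \<open>N\<close> be the finite measure
  on \<open>T\<close> with density \<open>exp (- (norm t)\<^sup>2 - 1)\<close>. Then the dual function is
  \<open>L l = g \<bullet> l - \<integral> exp (l \<bullet> u) \<partial>N\<close>, and the proof compares it with the following separation condition: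
  \<open>g \<bullet> v < 0\<close> for every \<open>v \<noteq> 0\<close> such that \<open>v \<bullet> u \<le> 0\<close> almost everywhere.

  Separation makes \<open>L\<close> coercive (\<open>dual_superlevel_bounded\<close>): along a direction \<open>v\<close> either \<open>v \<bullet> u\<close> is
  positive on a set of positive measure, and the exponential integral beats the linear term, or
  the linear term itself tends to minus infinity; a compactness argument makes this uniform in the direction.
  Hence \<open>L\<close> has a maximum, and vanishing of the partial derivatives there says that
  \<open>\<integral> u\<^sub>i * exp (l \<bullet> u) \<partial>N = g i\<close> (\<open>dual_max_imp_moments\<close>). These are exactly the moment equations for
  \<open>opt_density\<close>, which is therefore a solution of the moment problem.

  Both (a) and (b) imply separation. In (a) the entropy of \<open>f\<close> may be infinite, in which case
  Fenchel duality gives no bound for \<open>L\<close>; but \<open>g \<bullet> v\<close> is the integral of the polynomial \<open>\<Sum>i. v i * t\<^sup>i\<close>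
  against \<open>f\<close>, which is nonpositive, and it cannot vanish because a nonzero polynomial has a null
  zero set while \<open>f\<close> has total mass 1. In (b), if \<open>v \<bullet> u < 0\<close> almost everywhere and \<open>g \<bullet> v \<ge> 0\<close>,
  then translating any \<open>a\<close> far along \<open>v\<close> kills the exponential integral and shows that \<open>g \<bullet> a\<close> is at most
  the bound of \<open>L\<close>; a linear form that is bounded above is 0, whereas \<open>g 0 = 1\<close>.\<close>

section \<open>Convergent subsequences and bounds for the exponential\<close>

lemma bounded_family_convergent_subseq:
  fixes X :: "nat \<Rightarrow> 'i \<Rightarrow> real"
  assumes "finite I" and bnd: "\<And>n i. i \<in> I \<Longrightarrow> \<bar>X n i\<bar> \<le> R"
  obtains r l where "strict_mono (r :: nat \<Rightarrow> nat)" "\<And>i. i \<in> I \<Longrightarrow> (\<lambda>n. X (r n) i) \<longlonglongrightarrow> l i"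
proof -
  have "\<exists>r::nat\<Rightarrow>nat. strict_mono r \<and> (\<forall>i\<in>I. convergent (\<lambda>n. X (r n) i))"
    using assms
  proof (induction I)
    case empty
    show ?case by (auto intro: strict_mono_id)
  next
    case (insert a I)
    then obtain r :: "nat \<Rightarrow> nat" where r: "strict_mono r" "\<forall>i\<in>I. convergent (\<lambda>n. X (r n) i)" by auto
    have "bounded (range (\<lambda>n. X (r n) a))"
      using insert.prems by (auto simp: bounded_iff)
    then obtain l q where q: "strict_mono (q :: nat \<Rightarrow> nat)" "((\<lambda>n. X (r n) a) \<circ> q) \<longlonglongrightarrow> l"
      using bounded_imp_convergent_subsequence by blast
    have "convergent (\<lambda>n. X (r (q n)) i)" if "i \<in> I" for i
      using convergent_subseq_convergent[OF _ q(1), of "\<lambda>n. X (r n) i"] r(2) that by (auto simp: o_def)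
    moreover have "convergent (\<lambda>n. X (r (q n)) a)"
      using q(2) by (auto simp: o_def convergent_def)
    ultimately show ?case
      using strict_mono_o[OF r(1) q(1)] by (intro exI[of _ "r \<circ> q"]) (auto simp: o_def)
  qed
  then show ?thesis
    using that[of _ "\<lambda>i. lim (\<lambda>n. X (_ n) i)"] by (auto simp: convergent_LIMSEQ_iff)
qed

text \<open>For negative \<open>x\<close> invert the lower bound for \<open>exp (- x)\<close>: the product of
  \<open>1 + x + x\<^sup>2\<close> and \<open>1 - x + x\<^sup>2 / 2\<close> is \<open>1 + x\<^sup>2 / 2 - x ^ 3 / 2 + x ^ 4 / 2\<close>, which is at least 1.\<close>

lemma exp_upper_quadratic:
  fixes x :: real
  assumes "\<bar>x\<bar> \<le> 1"
  shows "exp x \<le> 1 + x + x\<^sup>2"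
proof (cases "0 \<le> x")
  case True
  then show ?thesis using assms by (intro exp_bound) auto
next
  case False
  have "1 + - x + (- x)\<^sup>2 / 2 \<le> exp (- x)"
    using False by (intro exp_lower_Taylor_quadratic) auto
  moreover have "1 - x + x\<^sup>2 / 2 > 0" using False by (simp add: add_pos_nonneg)
  ultimately have "exp x \<le> 1 / (1 - x + x\<^sup>2 / 2)"
    by (simp add: exp_minus field_simps)
  also have "\<dots> \<le> 1 + x + x\<^sup>2"
  proof -
    have "x ^ 3 \<le> 0" using False by (simp add: power3_eq_cube mult_nonneg_nonpos zero_le_mult_iff mult_le_0_iff)
    moreover have "0 \<le> x ^ 4" by simp
    ultimately have "1 \<le> 1 + x\<^sup>2 / 2 - x ^ 3 / 2 + x ^ 4 / 2"
      using zero_le_power2[of x] \<open>0 \<le> x ^ 4\<close> by linarith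
    also have "\<dots> = (1 + x + x\<^sup>2) * (1 - x + x\<^sup>2 / 2)" by (simp add: field_simps power2_eq_square power3_eq_cube power4_eq_xxxx)
    finally show ?thesis using \<open>1 - x + x\<^sup>2 / 2 > 0\<close> by (simp add: field_simps)
  qed
  finally show ?thesis .
qed

section \<open>The dual function of an exponential family with bounded features\<close>

locale bounded_features = finite_measure N for N :: "'a measure" +
  fixes I :: "'i set" and u :: "'i \<Rightarrow> 'a \<Rightarrow> real"
  assumes finite_index: "finite I"
    and features_measurable [measurable]: "\<And>i. i \<in> I \<Longrightarrow> u i \<in> borel_measurable N"
    and features_bounded: "\<And>i x. i \<in> I \<Longrightarrow> \<bar>u i x\<bar> \<le> 1"
begin

definition lincomb :: "('i \<Rightarrow> real) \<Rightarrow> 'a \<Rightarrow> real" where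
  "lincomb l x = (\<Sum>i\<in>I. l i * u i x)"

definition partition_fun :: "('i \<Rightarrow> real) \<Rightarrow> real" where
  "partition_fun l = (\<integral>x. exp (lincomb l x) \<partial>N)"

definition dual :: "('i \<Rightarrow> real) \<Rightarrow> ('i \<Rightarrow> real) \<Rightarrow> real" where
  "dual g l = (\<Sum>i\<in>I. g i * l i) - partition_fun l"

lemma lincomb_measurable [measurable]: "lincomb l \<in> borel_measurable N"
  unfolding lincomb_def[abs_def] by measurable

lemma abs_lincomb_le: "\<bar>lincomb l x\<bar> \<le> (\<Sum>i\<in>I. \<bar>l i\<bar>)"
proof -
  have "\<bar>lincomb l x\<bar> \<le> (\<Sum>i\<in>I. \<bar>l i * u i x\<bar>)" unfolding lincomb_def by (rule sum_abs)
  also have "\<dots> \<le> (\<Sum>i\<in>I. \<bar>l i\<bar>)"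
    by (intro sum_mono) (auto simp: abs_mult features_bounded intro: mult_left_le)
  finally show ?thesis .
qed

lemma lincomb_linear: "lincomb (\<lambda>i. a i + s * v i) x = lincomb a x + s * lincomb v x"
  by (simp add: lincomb_def sum.distrib sum_distrib_left algebra_simps)

lemma integrable_exp_lincomb [simp]: "integrable N (\<lambda>x. exp (lincomb l x))"
  using abs_lincomb_le[of l]
  by (intro integrable_const_bound[where B = "exp (\<Sum>i\<in>I. \<bar>l i\<bar>)"]) (auto simp: abs_le_iff)

lemma partition_fun_nonneg: "0 \<le> partition_fun l"
  unfolding partition_fun_def by (rule Bochner_Integration.integral_nonneg) auto

lemma partition_fun_0: "partition_fun (\<lambda>_. 0) = measure N (space N)"
  by (simp add: partition_fun_def lincomb_def)

lemma lincomb_tendsto: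
  assumes "\<And>i. i \<in> I \<Longrightarrow> (\<lambda>n. X n i) \<longlonglongrightarrow> l i"
  shows "(\<lambda>n. lincomb (X n) x) \<longlonglongrightarrow> lincomb l x"
  unfolding lincomb_def by (intro tendsto_intros assms)

text \<open>A convergent sequence of parameters is bounded in the sum norm, so the exponentials are dominated
  by a constant, which is integrable because \<open>N\<close> is finite.\<close>

lemma partition_fun_tendsto:
  assumes X: "\<And>i. i \<in> I \<Longrightarrow> (\<lambda>n. X n i) \<longlonglongrightarrow> l i"
  shows "(\<lambda>n. partition_fun (X n)) \<longlonglongrightarrow> partition_fun l"
proof -
  have "(\<lambda>n. \<Sum>i\<in>I. \<bar>X n i\<bar>) \<longlonglongrightarrow> (\<Sum>i\<in>I. \<bar>l i\<bar>)" by (intro tendsto_intros X)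
  then have "Bseq (\<lambda>n. \<Sum>i\<in>I. \<bar>X n i\<bar>)" by (intro convergent_imp_Bseq convergentI)
  then obtain B where B: "\<And>n. \<bar>\<Sum>i\<in>I. \<bar>X n i\<bar>\<bar> \<le> B"
    unfolding Bseq_def by (metis real_norm_def)
  show ?thesis
    unfolding partition_fun_def
  proof (rule integral_dominated_convergence[where w = "\<lambda>_. exp B"])
    show "AE x in N. (\<lambda>n. exp (lincomb (X n) x)) \<longlonglongrightarrow> exp (lincomb l x)"
      by (intro always_eventually allI tendsto_intros lincomb_tendsto X)
    fix n
    have "lincomb (X n) x \<le> B" for x
      using abs_lincomb_le[of "X n" x] B[of n] by linarith
    then show "AE x in N. norm (exp (lincomb (X n) x)) \<le> exp B" by simp
  qed auto
qed

text \<open>Otherwise there are parameters \<open>L n = s n * V n\<close> with \<open>V n\<close> of sum norm 1, \<open>s n\<close> tending to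
  infinity and \<open>dual g (L n) \<ge> dual g 0\<close>. A limit point \<open>v\<close> of the directions \<open>V n\<close> violates the
  hypothesis: the exponential integral at \<open>L n\<close> exceeds its value at 0 by at most a multiple of \<open>s n\<close>,
  whereas it grows at least like \<open>(s n)\<^sup>2\<close> times the integral of the squared positive part of
  \<open>lincomb (V n)\<close>, so this positive part must vanish in the limit; and nonnegativity of the exponential
  integral forces the limit of \<open>\<Sum>i. g i * V n i\<close> to be nonnegative.\<close>

lemma dual_superlevel_bounded:
  assumes sep: "\<And>v. \<exists>i\<in>I. v i \<noteq> 0 \<Longrightarrow> AE x in N. lincomb v x \<le> 0 \<Longrightarrow> (\<Sum>i\<in>I. g i * v i) < 0"
  shows "\<exists>R. \<forall>l. dual g (\<lambda>_. 0) \<le> dual g l \<longrightarrow> (\<Sum>i\<in>I. \<bar>l i\<bar>) \<le> R"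
proof (rule ccontr)
  define M where "M = measure N (space N)"
  define G where "G = (\<Sum>i\<in>I. \<bar>g i\<bar>)"
  assume "\<not> ?thesis"
  then have "\<forall>n. \<exists>l. dual g (\<lambda>_. 0) \<le> dual g l \<and> real (Suc n) < (\<Sum>i\<in>I. \<bar>l i\<bar>)"
    by (meson not_le)
  then obtain L where L: "\<And>n. dual g (\<lambda>_. 0) \<le> dual g (L n)"
      and Lbig: "\<And>n. real (Suc n) < (\<Sum>i\<in>I. \<bar>L n i\<bar>)" by metis
  define s where "s n = (\<Sum>i\<in>I. \<bar>L n i\<bar>)" for n
  define V where "V n i = L n i / s n" for n i
  have s: "s n \<ge> 1" "s n \<ge> real (Suc n)" "s n > 0" for n using Lbig[of n] by (auto simp: s_def)
  have L_eq: "L n = (\<lambda>i. 0 + s n * V n i)" for n using s[of n] by (auto simp: V_def)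
  have V1: "(\<Sum>i\<in>I. \<bar>V n i\<bar>) = 1" for n
  proof -
    have "(\<Sum>i\<in>I. \<bar>V n i\<bar>) = (\<Sum>i\<in>I. \<bar>L n i\<bar>) / s n"
      using s(3)[of n] by (simp add: V_def sum_divide_distrib)
    also have "\<dots> = s n / s n" by (simp only: s_def)
    finally show ?thesis using s(3)[of n] by simp
  qed
  have V_le: "\<bar>V n i\<bar> \<le> 1" if "i \<in> I" for n i
    using member_le_sum[OF that, of "\<lambda>i. \<bar>V n i\<bar>"] finite_index V1[of n] by auto
  have Z: "partition_fun (L n) \<le> M + s n * (\<Sum>i\<in>I. g i * V n i)" for n
  proof -
    have "(\<Sum>i\<in>I. g i * L n i) = s n * (\<Sum>i\<in>I. g i * V n i)"
      unfolding sum_distrib_left using s(3)[of n] by (intro sum.cong) (auto simp: V_def)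
    then show ?thesis using L[of n] by (simp add: dual_def partition_fun_0 M_def)
  qed
  obtain r v where r: "strict_mono (r :: nat \<Rightarrow> nat)"
      and v: "\<And>i. i \<in> I \<Longrightarrow> (\<lambda>n. V (r n) i) \<longlonglongrightarrow> v i"
    using bounded_family_convergent_subseq[OF finite_index, of V 1] V_le by blast
  have inv: "(\<lambda>n. c / real (Suc (r n))) \<longlonglongrightarrow> 0" for c :: real
    using LIMSEQ_subseq_LIMSEQ[OF LIMSEQ_Suc[OF lim_const_over_n[of c]] r] by (simp add: o_def)
  have "(\<lambda>n. \<Sum>i\<in>I. \<bar>V (r n) i\<bar>) \<longlonglongrightarrow> (\<Sum>i\<in>I. \<bar>v i\<bar>)" by (intro tendsto_intros v)
  then have "(\<Sum>i\<in>I. \<bar>v i\<bar>) = 1" unfolding V1 by (simp add: LIMSEQ_const_iff)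
  then have nz: "\<exists>i\<in>I. v i \<noteq> 0" by (metis abs_zero sum.neutral zero_neq_one)
  \<comment> \<open>\<open>g \<bullet> V n \<ge> - M / s n\<close>, because the exponential integral at \<open>L n\<close> is nonnegative.\<close>
  have "0 \<le> (\<Sum>i\<in>I. g i * v i)"
  proof (rule LIMSEQ_le)
    show "(\<lambda>n. - M / real (Suc (r n))) \<longlonglongrightarrow> 0" by (rule inv)
    show "(\<lambda>n. \<Sum>i\<in>I. g i * V (r n) i) \<longlonglongrightarrow> (\<Sum>i\<in>I. g i * v i)" by (intro tendsto_intros v)
    have "- M / real (Suc n) \<le> (\<Sum>i\<in>I. g i * V n i)" for n
    proof -
      have "- M / real (Suc n) \<le> - M / s n" using s[of n] by (simp add: M_def divide_left_mono)
      also have "\<dots> \<le> (\<Sum>i\<in>I. g i * V n i)"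
        using Z[of n] partition_fun_nonneg[of "L n"] s(3)[of n] by (simp add: field_simps)
      finally show ?thesis .
    qed
    then show "\<exists>N. \<forall>n\<ge>N. - M / real (Suc (r n)) \<le> (\<Sum>i\<in>I. g i * V (r n) i)" by blast
  qed
  moreover have "AE x in N. lincomb v x \<le> 0"
  proof -
    \<comment> \<open>The square matches the quadratic term in the lower bound of the exponential.\<close>
    define q where "q l x = (max 0 (lincomb l x))\<^sup>2" for l x
    have q_meas [measurable]: "q l \<in> borel_measurable N" for l
      unfolding q_def[abs_def] by measurable
    have q_bound: "q l x \<le> (\<Sum>i\<in>I. \<bar>l i\<bar>)\<^sup>2" for l x
      unfolding q_def using abs_lincomb_le[of l x] by (intro power_mono) auto
    have q_int: "integrable N (q l)" for l
      using q_bound[of l] by (intro integrable_const_bound[where B = "(\<Sum>i\<in>I. \<bar>l i\<bar>)\<^sup>2"]) (auto simp: q_def)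
    have upper: "(\<integral>x. q (V n) x \<partial>N) \<le> 2 * (M + G) / real (Suc n)" for n
    proof -
      have "(\<Sum>i\<in>I. g i * V n i) \<le> (\<Sum>i\<in>I. \<bar>g i\<bar>)"
      proof (rule sum_mono)
        fix i assume "i \<in> I"
        then show "g i * V n i \<le> \<bar>g i\<bar>"
          using mult_left_le[OF V_le[of i n], of "\<bar>g i\<bar>"] abs_ge_self[of "g i * V n i"] by (simp add: abs_mult)
      qed
      then have G: "(\<Sum>i\<in>I. g i * V n i) \<le> G" by (simp add: G_def)
      have "(s n)\<^sup>2 / 2 * q (V n) x \<le> exp (lincomb (L n) x)" for x
      proof (cases "lincomb (V n) x \<le> 0")
        case False
        then have "1 + s n * lincomb (V n) x + (s n * lincomb (V n) x)\<^sup>2 / 2 \<le> exp (s n * lincomb (V n) x)"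
          using s(3)[of n] by (intro exp_lower_Taylor_quadratic) auto
        moreover have "0 \<le> s n * lincomb (V n) x" using False s(3)[of n] by simp
        moreover have "lincomb (L n) x = s n * lincomb (V n) x"
          using L_eq[of n] lincomb_linear[of "\<lambda>_. 0" "s n" "V n" x] by (simp add: lincomb_def)
        ultimately show ?thesis using False by (simp add: q_def power_mult_distrib max_def)
      qed (simp add: q_def max_def)
      then have "(\<integral>x. (s n)\<^sup>2 / 2 * q (V n) x \<partial>N) \<le> partition_fun (L n)"
        unfolding partition_fun_def by (intro integral_mono integrable_mult_right q_int) auto
      then have "(s n)\<^sup>2 / 2 * (\<integral>x. q (V n) x \<partial>N) \<le> M + s n * G"
        using Z[of n] mult_left_mono[OF G less_imp_le[OF s(3)[of n]]] by (auto simp only: integral_mult_right_zero)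
      also have "\<dots> \<le> s n * (M + G)"
        using mult_right_mono[OF s(1)[of n], of M] by (simp add: M_def algebra_simps)
      finally have "s n * (s n * (\<integral>x. q (V n) x \<partial>N)) \<le> s n * (2 * (M + G))"
        by (simp add: power2_eq_square algebra_simps)
      then have "s n * (\<integral>x. q (V n) x \<partial>N) \<le> 2 * (M + G)"
        using s(3)[of n] by (rule mult_left_le_imp_le)
      then have "(\<integral>x. q (V n) x \<partial>N) \<le> 2 * (M + G) / s n"
        using s(3)[of n] by (simp add: pos_le_divide_eq mult.commute)
      also have "\<dots> \<le> 2 * (M + G) / real (Suc n)"
        using s[of n] by (intro divide_left_mono) (auto simp: M_def G_def sum_nonneg)
      finally show ?thesis .
    qed
    have lim: "(\<lambda>n. \<integral>x. q (V (r n)) x \<partial>N) \<longlonglongrightarrow> (\<integral>x. q v x \<partial>N)"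
    proof (rule integral_dominated_convergence[where w = "\<lambda>_. 1"])
      show "AE x in N. (\<lambda>n. q (V (r n)) x) \<longlonglongrightarrow> q v x"
        unfolding q_def by (intro always_eventually allI tendsto_intros lincomb_tendsto v)
      show "AE x in N. norm (q (V (r n)) x) \<le> 1" for n
        using q_bound[of "V (r n)"] by (auto simp: V1 q_def)
    qed auto
    have "(\<integral>x. q v x \<partial>N) \<le> 0"
      by (rule LIMSEQ_le[OF lim inv]) (use upper in blast)
    moreover have "(\<integral>x. q v x \<partial>N) \<ge> 0" by (rule Bochner_Integration.integral_nonneg) (simp add: q_def)
    ultimately have "(\<integral>x. q v x \<partial>N) = 0" by linarith
    then have "AE x in N. q v x = 0"
      by (subst (asm) integral_nonneg_eq_0_iff_AE) (auto intro: q_int simp: q_def)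
    then show ?thesis by eventually_elim (auto simp: q_def max_def split: if_splits)
  qed
  ultimately show False using sep[OF nz] by simp
qed

text \<open>Every point outside a certain compact ball has a smaller value than the origin, so it suffices to
  maximise over this ball, where a maximising sequence has a convergent subsequence.\<close>

lemma dual_attains_max:
  assumes "\<And>v. \<exists>i\<in>I. v i \<noteq> 0 \<Longrightarrow> AE x in N. lincomb v x \<le> 0 \<Longrightarrow> (\<Sum>i\<in>I. g i * v i) < 0"
  obtains l where "\<And>l'. dual g l' \<le> dual g l"
proof -
  obtain R where R: "\<And>l. dual g (\<lambda>_. 0) \<le> dual g l \<Longrightarrow> (\<Sum>i\<in>I. \<bar>l i\<bar>) \<le> R"
    using dual_superlevel_bounded[OF assms] by blast
  define A where "A = {l. (\<Sum>i\<in>I. \<bar>l i\<bar>) \<le> R}"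
  define S where "S = (SUP l\<in>A. dual g l)"
  have zero: "(\<lambda>_. 0) \<in> A" using R[of "\<lambda>_. 0"] by (simp add: A_def)
  have A_le: "\<bar>l i\<bar> \<le> R" if "l \<in> A" "i \<in> I" for l i
    using member_le_sum[OF that(2), of "\<lambda>i. \<bar>l i\<bar>"] finite_index that by (auto simp: A_def)
  have "dual g l \<le> (\<Sum>i\<in>I. \<bar>g i\<bar> * R)" if "l \<in> A" for l
  proof -
    have "(\<Sum>i\<in>I. g i * l i) \<le> (\<Sum>i\<in>I. \<bar>g i\<bar> * R)"
    proof (rule sum_mono)
      fix i assume "i \<in> I"
      then show "g i * l i \<le> \<bar>g i\<bar> * R"
        using mult_left_mono[OF A_le[OF that, of i], of "\<bar>g i\<bar>"] abs_ge_self[of "g i * l i"] by (simp add: abs_mult)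
    qed
    then show ?thesis using partition_fun_nonneg[of l] by (simp add: dual_def)
  qed
  then have bdd: "bdd_above (dual g ` A)" by (auto simp: bdd_above_def)
  have le_S: "dual g l \<le> S" for l
  proof (cases "l \<in> A")
    case True
    then show ?thesis unfolding S_def by (intro cSUP_upper bdd)
  next
    case False
    then have "dual g l \<le> dual g (\<lambda>_. 0)" using R[of l] by (force simp: A_def)
    also have "\<dots> \<le> S" unfolding S_def by (intro cSUP_upper bdd zero)
    finally show ?thesis .
  qed
  have "\<exists>l\<in>A. S - 1 / real (Suc n) < dual g l" for n
    using less_cSUP_iff[OF _ bdd, of "S - 1 / real (Suc n)"] zero by (auto simp: S_def[symmetric])
  then obtain X where X: "\<And>n. X n \<in> A" "\<And>n. S - 1 / real (Suc n) < dual g (X n)" by metis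
  obtain r l where r: "strict_mono (r :: nat \<Rightarrow> nat)"
      and l: "\<And>i. i \<in> I \<Longrightarrow> (\<lambda>n. X (r n) i) \<longlonglongrightarrow> l i"
    using bounded_family_convergent_subseq[OF finite_index, of X R] A_le[OF X(1)] by blast
  have "S - 0 \<le> dual g l"
  proof (rule LIMSEQ_le)
    have "(\<lambda>n. 1 / real (Suc (r n))) \<longlonglongrightarrow> 0"
      using LIMSEQ_subseq_LIMSEQ[OF LIMSEQ_Suc[OF lim_const_over_n[of 1]] r] by (simp add: o_def)
    then show "(\<lambda>n. S - 1 / real (Suc (r n))) \<longlonglongrightarrow> S - 0" by (intro tendsto_intros)
    show "(\<lambda>n. dual g (X (r n))) \<longlonglongrightarrow> dual g l"
      unfolding dual_def by (intro tendsto_intros l partition_fun_tendsto)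
  qed (use X(2) less_imp_le in blast)
  then show ?thesis using that[of l] le_S by (metis diff_zero order_trans)
qed

text \<open>Moving the parameter by \<open>s\<close> in the coordinate \<open>i\<close> changes the dual function by
  \<open>s * (g i - m)\<close> up to an error of order \<open>s\<^sup>2\<close>, where \<open>m\<close> is the integral in question. The error is
  controlled by the quadratic bound for \<open>exp\<close> under the integral, which replaces differentiation of
  parameter integrals. At a maximum both signs of \<open>s\<close> give \<open>g i = m\<close>.\<close>

lemma dual_max_imp_moments:
  assumes max: "\<And>l'. dual g l' \<le> dual g l" and i: "i \<in> I"
  shows "has_bochner_integral N (\<lambda>x. u i x * exp (lincomb l x)) (g i)"
proof -
  define m where "m = (\<integral>x. u i x * exp (lincomb l x) \<partial>N)"
  define Z where "Z = partition_fun l"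
  have [measurable]: "u i \<in> borel_measurable N" by (rule features_measurable[OF i])
  have int: "integrable N (\<lambda>x. u i x * exp (lincomb l x))"
    using features_bounded[OF i]
    by (intro Bochner_Integration.integrable_bound[OF integrable_exp_lincomb[of l]])
       (auto simp: abs_mult)
  have step: "s * g i \<le> s * m + s\<^sup>2 * Z" if s: "\<bar>s\<bar> \<le> 1" for s
  proof -
    define e where "e = (\<lambda>j. if j = i then 1 else 0 :: real)"
    have e: "(\<Sum>j\<in>I. c j * e j) = c i" "(\<Sum>j\<in>I. e j * c j) = c i" for c
      using i finite_index unfolding e_def
      by (simp_all add: sum.remove[of I i])
    have "(\<Sum>j\<in>I. g j * (l j + s * e j)) = (\<Sum>j\<in>I. g j * l j) + s * (\<Sum>j\<in>I. g j * e j)"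
      by (simp add: sum.distrib sum_distrib_left algebra_simps)
    then have "s * g i \<le> partition_fun (\<lambda>j. l j + s * e j) - Z"
      using max[of "\<lambda>j. l j + s * e j"] by (simp add: dual_def Z_def e)
    also have "partition_fun (\<lambda>j. l j + s * e j) \<le>
        (\<integral>x. exp (lincomb l x) + s * (u i x * exp (lincomb l x)) + s\<^sup>2 * exp (lincomb l x) \<partial>N)"
      unfolding partition_fun_def
    proof (rule integral_mono)
      fix x
      have ux: "\<bar>u i x\<bar> \<le> 1" by (rule features_bounded[OF i])
      have "\<bar>s * u i x\<bar> \<le> 1" using mult_mono[OF s ux] by (simp add: abs_mult)
      then have "exp (s * u i x) \<le> 1 + s * u i x + (s * u i x)\<^sup>2" by (rule exp_upper_quadratic)
      also have "\<dots> \<le> 1 + s * u i x + s\<^sup>2"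
        using ux by (simp add: power_mult_distrib abs_square_le_1 mult_left_le)
      finally have "exp (lincomb l x) * exp (s * u i x) \<le> exp (lincomb l x) * (1 + s * u i x + s\<^sup>2)"
        by simp
      moreover have "lincomb (\<lambda>j. l j + s * e j) x = lincomb l x + s * u i x"
        unfolding lincomb_linear by (simp add: lincomb_def e)
      ultimately show "exp (lincomb (\<lambda>j. l j + s * e j) x) \<le>
          exp (lincomb l x) + s * (u i x * exp (lincomb l x)) + s\<^sup>2 * exp (lincomb l x)"
        by (simp add: exp_add algebra_simps)
    qed (simp, intro Bochner_Integration.integrable_add integrable_mult_right int integrable_exp_lincomb)
    also have "\<dots> = Z + s * m + s\<^sup>2 * Z"
      using int by (simp add: Z_def m_def partition_fun_def)
    finally show ?thesis by simp
  qed
  have lim: "(\<lambda>n. c * (Z / real (Suc n))) \<longlonglongrightarrow> 0" for c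
    using LIMSEQ_Suc[OF lim_const_over_n[of "c * Z"]] by simp
  have "g i - m \<le> 1 * (Z / real (Suc n))" for n
    using step[of "1 / real (Suc n)"] by (simp add: field_simps power2_eq_square del: of_nat_Suc)
  then have "g i - m \<le> 0" by (intro LIMSEQ_le_const[OF lim[of 1]]) blast
  moreover have "m - g i \<le> 1 * (Z / real (Suc n))" for n
    using step[of "- 1 / real (Suc n)"] by (simp add: field_simps power2_eq_square del: of_nat_Suc)
  then have "m - g i \<le> 0" by (intro LIMSEQ_le_const[OF lim[of 1]]) blast
  ultimately show ?thesis using int by (simp add: has_bochner_integral_iff m_def)
qed

text \<open>If \<open>g \<bullet> v \<ge> 0\<close>, then along the ray \<open>a + n * v\<close> the linear part never drops below \<open>g \<bullet> a\<close> while the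
  exponential integral tends to 0. So the linear form \<open>a \<mapsto> g \<bullet> a\<close> is bounded by \<open>K\<close>, which is absurd
  unless it is zero.\<close>

lemma bounded_dual_imp_separation:
  assumes K: "\<And>l. dual g l \<le> K" and i0: "i0 \<in> I" "g i0 \<noteq> 0"
    and v: "AE x in N. lincomb v x < 0"
  shows "(\<Sum>i\<in>I. g i * v i) < 0"
proof (rule ccontr)
  assume "\<not> ?thesis"
  then have gv: "0 \<le> (\<Sum>i\<in>I. g i * v i)" by simp
  have all: "(\<Sum>i\<in>I. g i * a i) \<le> K" for a
  proof -
    let ?W = "\<lambda>n i. a i + real n * v i"
    have "(\<lambda>n. partition_fun (?W n)) \<longlonglongrightarrow> (\<integral>x. 0 \<partial>N)"
      unfolding partition_fun_def
    proof (rule integral_dominated_convergence[where w = "\<lambda>x. exp (lincomb a x)"])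
      show "AE x in N. (\<lambda>n. exp (lincomb (?W n) x)) \<longlonglongrightarrow> 0"
        using v
      proof eventually_elim
        fix x assume "lincomb v x < 0"
        then have "(\<lambda>n. exp (lincomb a x) * exp (lincomb v x) ^ n) \<longlonglongrightarrow> exp (lincomb a x) * 0"
          by (intro tendsto_intros LIMSEQ_realpow_zero) auto
        then show "(\<lambda>n. exp (lincomb (?W n) x)) \<longlonglongrightarrow> 0"
          by (simp add: lincomb_linear exp_add exp_of_nat_mult)
      qed
      show "AE x in N. norm (exp (lincomb (?W n) x)) \<le> exp (lincomb a x)" for n
        using v by eventually_elim (simp add: lincomb_linear mult_nonneg_nonpos)
    qed auto
    then have "(\<lambda>n. K + partition_fun (?W n)) \<longlonglongrightarrow> K + (\<integral>x. 0 \<partial>N)" by (intro tendsto_intros)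
    moreover have "(\<Sum>i\<in>I. g i * a i) \<le> K + partition_fun (?W n)" for n
    proof -
      have "(\<Sum>i\<in>I. g i * a i) \<le> (\<Sum>i\<in>I. g i * a i) + real n * (\<Sum>i\<in>I. g i * v i)"
        using gv by simp
      also have "\<dots> = (\<Sum>i\<in>I. g i * ?W n i)"
        by (simp add: sum.distrib sum_distrib_left algebra_simps)
      finally show ?thesis using K[of "?W n"] by (simp add: dual_def)
    qed
    ultimately have "(\<Sum>i\<in>I. g i * a i) \<le> K + (\<integral>x. 0 \<partial>N)" by (intro LIMSEQ_le_const) auto
    then show ?thesis by simp
  qed
  have "(\<Sum>i\<in>I. g i * (if i = i0 then (K + 1) / g i0 else 0)) = K + 1"
    using i0 finite_index by (simp add: if_distrib sum.delta cong: if_cong)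
  then show False using all[of "\<lambda>i. if i = i0 then (K + 1) / g i0 else 0"] by simp
qed

end

section \<open>Zero sets of polynomials in several variables\<close>

lemma univariate_coefficient_zero:
  fixes A :: "'i \<Rightarrow> real"
  assumes "finite I" and "\<And>y. (\<Sum>i\<in>I. A i * y ^ e i) = 0"
  shows "(\<Sum>i | i \<in> I \<and> e i = m. A i) = 0"
proof -
  define p where "p = (\<Sum>i\<in>I. monom (A i) (e i))"
  have "\<forall>y. poly p y = 0"
    by (simp add: p_def poly_sum poly_monom assms(2))
  then have "coeff p m = 0" by (simp only: poly_all_0_iff_0 coeff_0)
  then show ?thesis
    using assms(1) by (simp add: p_def coeff_sum sum.If_cases Int_def)
qed

text \<open>The induction is on the set \<open>S\<close> of variables. To remove a variable \<open>a\<close>, compare coefficients with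
  respect to it: each group of indices with the same exponent at \<open>a\<close> gives a vanishing polynomial in
  the remaining variables. The indices in such a group still differ only inside \<open>S\<close>; the third
  premise is this invariant.\<close>

lemma monomials_independent:
  fixes v :: "('n \<Rightarrow> nat) \<Rightarrow> real"
  assumes "finite S" "finite I"
    and "\<And>i i' j. i \<in> I \<Longrightarrow> i' \<in> I \<Longrightarrow> j \<notin> S \<Longrightarrow> i j = i' j"
    and "\<And>x. (\<Sum>i\<in>I. v i * (\<Prod>j\<in>S. x j ^ i j)) = 0"
    and "i \<in> I"
  shows "v i = 0"
  using assms
proof (induction S arbitrary: I rule: finite_induct)
  case empty
  then have "I = {i}" by (auto simp: fun_eq_iff)
  with empty.prems(3) show ?case by simp
next
  case (insert a S)
  define I' where "I' = {i' \<in> I. i' a = i a}"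
  have "(\<Sum>i'\<in>I'. v i' * (\<Prod>j\<in>S. x j ^ i' j)) = 0" for x
    unfolding I'_def
  proof (rule univariate_coefficient_zero[OF insert.prems(1)])
    fix y
    have "(\<Sum>i\<in>I. v i * (\<Prod>j\<in>S. x j ^ i j) * y ^ i a) =
        (\<Sum>i\<in>I. v i * (\<Prod>j\<in>insert a S. (x(a := y)) j ^ i j))"
    proof (rule sum.cong)
      fix i'
      have "(\<Prod>j\<in>S. (x(a := y)) j ^ i' j) = (\<Prod>j\<in>S. x j ^ i' j)"
        using insert.hyps by (intro prod.cong) auto
      then show "v i' * (\<Prod>j\<in>S. x j ^ i' j) * y ^ i' a = v i' * (\<Prod>j\<in>insert a S. (x(a := y)) j ^ i' j)"
        using insert.hyps by simp
    qed simp
    then show "(\<Sum>i\<in>I. v i * (\<Prod>j\<in>S. x j ^ i j) * y ^ i a) = 0"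
      using insert.prems(3)[of "x(a := y)"] by simp
  qed
  moreover have "i' j = i'' j" if "i' \<in> I'" "i'' \<in> I'" "j \<notin> S" for i' i'' j
    using that insert.prems(2)[of i' i'' j] by (cases "j = a") (auto simp: I'_def)
  moreover have "finite I'" "i \<in> I'"
    using insert.prems(1,4) by (auto simp: I'_def)
  ultimately show ?case by (intro insert.IH[of I']) blast+
qed

lemma continuous_on_mi_monom [continuous_intros]:
  assumes "continuous_on S f"
  shows "continuous_on S (\<lambda>x. mi_monom (f x) i)"
  unfolding mi_monom_def by (intro continuous_intros assms)

lemma borel_measurable_mi_monom [measurable]: "(\<lambda>t. mi_monom t i) \<in> borel_measurable borel"
  by (intro borel_measurable_continuous_onI continuous_intros)

lemma finite_zeros_on_ray:
  fixes a x :: "real ^ 'n::finite"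
  assumes "(\<Sum>i\<in>I. v i * mi_monom a i) \<noteq> 0"
  shows "finite {c. (\<Sum>i\<in>I. v i * mi_monom (a + c *\<^sub>R x) i) = 0}"
proof -
  define p where "p = (\<Sum>i\<in>I. smult (v i) (\<Prod>j\<in>UNIV. [:a $ j, x $ j:] ^ i j))"
  have p: "poly p c = (\<Sum>i\<in>I. v i * mi_monom (a + c *\<^sub>R x) i)" for c
    by (simp add: p_def poly_sum poly_prod mi_monom_def)
  have "poly p 0 \<noteq> 0" using assms by (simp add: p)
  then have "p \<noteq> 0" by auto
  then have "finite {c. poly p c = 0}" by (rule poly_roots_finite)
  then show ?thesis by (simp add: p)
qed

text \<open>Pick a point \<open>a\<close> where the polynomial does not vanish. On every line through \<open>a\<close> it has only finitely
  many zeros, so the set of pairs \<open>(c, x)\<close> for which \<open>a + c *\<^sub>R x\<close> is a zero is null by Fubini.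
  Slicing the other way, for almost every \<open>c\<close>, hence for some \<open>c \<noteq> 0\<close>, the set of such \<open>x\<close> is null,
  and \<open>x \<mapsto> a + c *\<^sub>R x\<close> carries it onto the zero set of the polynomial.\<close>

lemma AE_polynomial_nonzero:
  fixes v :: "'n::finite multi_index \<Rightarrow> real"
  assumes "finite I" and nz: "\<exists>i\<in>I. v i \<noteq> 0"
  shows "AE t in lebesgue. (\<Sum>i\<in>I. v i * mi_monom (t :: real ^ 'n) i) \<noteq> 0"
proof -
  define p where "p t = (\<Sum>i\<in>I. v i * mi_monom t i)" for t :: "real ^ 'n"
  have p_cont [continuous_intros]: "continuous_on S (\<lambda>x. p (f x))" if "continuous_on S f" for S f
    unfolding p_def by (intro continuous_intros that)
  have "\<exists>a. p a \<noteq> 0"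
  proof (rule ccontr)
    assume "\<not> ?thesis"
    then have "(\<Sum>i\<in>I. v i * (\<Prod>j\<in>UNIV. x j ^ i j)) = 0" for x
      using spec[of "\<lambda>a. p a = 0" "\<chi> j. x j"] by (simp add: p_def mi_monom_def)
    then show False using monomials_independent[of UNIV I v] nz assms(1) by auto
  qed
  then obtain a where a: "p a \<noteq> 0" ..
  have "AE c in lborel. p (a + c *\<^sub>R x) \<noteq> 0" for x
  proof (rule AE_I')
    show "{c. p (a + c *\<^sub>R x) = 0} \<in> null_sets lborel"
      using finite_zeros_on_ray[of v a I x] a by (intro finite_imp_null_set_lborel) (simp add: p_def)
  qed auto
  then have "AE x in lborel. AE c in lborel. p (a + c *\<^sub>R x) \<noteq> 0" by simp
  moreover have "{z \<in> space (lborel \<Otimes>\<^sub>M lborel). p (a + fst z *\<^sub>R snd z) \<noteq> 0} \<in> sets (lborel \<Otimes>\<^sub>M lborel)"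
  proof -
    have "open {z. p (a + fst z *\<^sub>R snd z) \<noteq> 0}"
      by (intro open_Collect_neq continuous_intros)
    then show ?thesis unfolding lborel_prod by simp
  qed
  ultimately have "AE c in lborel. AE x in lborel. p (a + c *\<^sub>R x) \<noteq> 0"
    by (subst lborel_pair.AE_commute) (simp_all add: case_prod_beta')
  moreover have "AE c in lborel. c \<noteq> (0 :: real)"
    by (rule AE_lborel_singleton)
  ultimately have "AE c in lborel. c \<noteq> 0 \<and> (AE x in lborel. p (a + c *\<^sub>R x) \<noteq> 0)"
    by eventually_elim simp
  then obtain Z where Z: "{c. \<not> (c \<noteq> 0 \<and> (AE x in lborel. p (a + c *\<^sub>R x) \<noteq> 0))} \<subseteq> Z"
      and "emeasure lborel Z = 0"
    by (elim AE_E) auto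
  then have "Z \<noteq> UNIV" by (metis emeasure_lborel_UNIV infinity_ennreal_def ennreal_zero_neq_top)
  with Z obtain c where c: "c \<noteq> 0" "AE x in lborel. p (a + c *\<^sub>R x) \<noteq> 0" by blast
  have "{t. p t \<noteq> 0} \<in> sets borel" by (intro borel_open open_Collect_neq continuous_intros)
  then have "AE t in distr lborel borel (\<lambda>x. a + c *\<^sub>R x). p t \<noteq> 0"
    using c(2) by (subst AE_distr_iff) auto
  then have "AE t in lborel. p t \<noteq> 0"
    by (subst lborel_affine[OF c(1), of a], subst AE_density) (auto elim: eventually_mono)
  then show ?thesis unfolding p_def by (rule AE_completion)
qed

lemma finite_multi_indices [simp]: "finite (multi_indices d :: 'n::finite multi_index set)"
proof (rule finite_subset)
  show "multi_indices d \<subseteq> (UNIV :: 'n set) \<rightarrow>\<^sub>E {..d}"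
  proof
    fix i :: "'n multi_index" assume "i \<in> multi_indices d"
    then have "i j \<le> d" for j
      using member_le_sum[of j UNIV i] by (simp add: multi_indices_def mi_degree_def)
    then show "i \<in> UNIV \<rightarrow>\<^sub>E {..d}" by (simp add: PiE_UNIV_domain)
  qed
qed (simp add: finite_PiE)

text \<open>The monomial is at most \<open>norm t ^ mi_degree i\<close>; inside the unit ball this is at most 1, outside it
  is at most \<open>norm t ^ d\<close>.\<close>

lemma abs_mi_monom_le:
  fixes t :: "real ^ 'n::finite"
  assumes "i \<in> multi_indices d"
  shows "\<bar>mi_monom t i\<bar> \<le> norm t ^ d + 1"
proof -
  have "\<bar>mi_monom t i\<bar> = (\<Prod>j\<in>UNIV. \<bar>t $ j\<bar> ^ i j)"
    by (simp add: mi_monom_def abs_prod power_abs)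
  also have "\<dots> \<le> (\<Prod>j\<in>UNIV. norm t ^ i j)"
    by (intro prod_mono conjI power_mono component_le_norm_cart) auto
  also have "\<dots> = norm t ^ mi_degree i" by (simp add: mi_degree_def power_sum)
  also have "\<dots> \<le> norm t ^ d + 1"
  proof (cases "norm t \<le> 1")
    case True
    then show ?thesis by (intro add_increasing) (auto intro: power_le_one)
  next
    case False
    then have "norm t ^ mi_degree i \<le> norm t ^ d"
      using assms by (intro power_increasing) (auto simp: multi_indices_def)
    then show ?thesis by linarith
  qed
  finally show ?thesis .
qed

text \<open>The integrand is a product of one-dimensional Gaussians over an orthonormal basis.\<close>

lemma integrable_gaussian: "integrable lborel (\<lambda>t :: 'a::euclidean_space. exp (- (norm t)\<^sup>2))"
proof (rule integrableI_bounded)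
  have one: "(\<integral>\<^sup>+ x. ennreal (exp (- x\<^sup>2)) \<partial>lborel) < \<infinity>"
  proof -
    have "exp (- x\<^sup>2) = sqrt pi * normal_density 0 (1 / sqrt 2) x" for x :: real
      by (simp add: normal_density_def power_divide real_sqrt_mult)
    moreover have "integrable lborel (\<lambda>x. sqrt pi * normal_density 0 (1 / sqrt 2) x)"
      by (intro integrable_mult_right integrable_normal_density) simp
    ultimately have "integrable lborel (\<lambda>x::real. exp (- x\<^sup>2))" by simp
    then show ?thesis by (simp add: integrable_iff_bounded)
  qed
  have "(\<integral>\<^sup>+ t. ennreal (norm (exp (- (norm (t :: 'a))\<^sup>2))) \<partial>lborel)
      = (\<integral>\<^sup>+ t. (\<Prod>b\<in>(Basis :: 'a set). ennreal (exp (- (t \<bullet> b)\<^sup>2))) \<partial>lborel)"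
  proof (rule nn_integral_cong)
    fix t :: 'a
    have "(norm t)\<^sup>2 = (\<Sum>b\<in>Basis. (t \<bullet> b)\<^sup>2)"
      unfolding power2_norm_eq_inner by (subst euclidean_inner) (simp add: power2_eq_square)
    then have "exp (- (norm t)\<^sup>2) = (\<Prod>b\<in>Basis. exp (- (t \<bullet> b)\<^sup>2))"
      by (simp only: exp_sum[symmetric] finite_Basis sum_negf)
    then show "ennreal (norm (exp (- (norm t)\<^sup>2))) = (\<Prod>b\<in>Basis. ennreal (exp (- (t \<bullet> b)\<^sup>2)))"
      by (simp add: prod_ennreal abs_prod)
  qed
  also have "\<dots> = (\<Prod>b\<in>(Basis :: 'a set). \<integral>\<^sup>+ x. ennreal (exp (- x\<^sup>2)) \<partial>lborel)"
    by (intro nn_integral_lborel_prod) auto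
  also have "\<dots> < \<infinity>"
    using one by (simp add: power_less_top_ennreal)
  finally show "(\<integral>\<^sup>+ t. ennreal (norm (exp (- (norm (t :: 'a))\<^sup>2))) \<partial>lborel) < \<infinity>" .
qed auto

section \<open>The Gaussian weight and the scaled monomials\<close>

definition gauss_measure :: "(real ^ 'n::finite) set \<Rightarrow> (real ^ 'n) measure" where
  "gauss_measure T = density (lebesgue_on T) (\<lambda>t. ennreal (exp (- (norm t)\<^sup>2 - 1)))"

text \<open>Dividing by \<open>norm t ^ (2 * k) + 1\<close> bounds every monomial of degree at most \<open>2 * k\<close> by 1.\<close>

definition scaled_monom :: "nat \<Rightarrow> 'n::finite multi_index \<Rightarrow> real ^ 'n \<Rightarrow> real" where
  "scaled_monom k i t = mi_monom t i / (norm t ^ (2 * k) + 1)"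

lemma one_plus_norm_pos: "0 < norm t ^ (2 * k) + 1"
  by (simp add: add_nonneg_pos)

lemma borel_measurable_lebesgue_onI:
  assumes "f \<in> borel_measurable borel"
  shows "f \<in> borel_measurable (lebesgue_on T)"
  using assms by (intro measurable_restrict_space1 measurable_completion) simp

lemma measurable_weight [measurable]:
  "(\<lambda>t :: real ^ 'n::finite. exp (- (norm t)\<^sup>2 - 1)) \<in> borel_measurable (lebesgue_on T)"
  by (rule borel_measurable_lebesgue_onI) measurable

lemma measurable_scaled_monom: "scaled_monom k i \<in> borel_measurable borel"
  unfolding scaled_monom_def[abs_def] by measurable

lemma measurable_mi_monom_lebesgue_on [measurable]:
  "(\<lambda>t. mi_monom t i) \<in> borel_measurable (lebesgue_on T)"
  by (rule borel_measurable_lebesgue_onI) measurable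

lemma AE_gauss_measure: "(AE t in gauss_measure T. P t) \<longleftrightarrow> (AE t in lebesgue_on T. P t)"
  unfolding gauss_measure_def by (subst AE_density) auto

lemma finite_measure_gauss_measure:
  assumes "T \<in> sets lebesgue"
  shows "finite_measure (gauss_measure T)"
proof
  have "integrable lebesgue (\<lambda>t :: real ^ 'n. exp (- (norm t)\<^sup>2) * exp (- 1))"
    by (intro integrable_mult_left integrable_completion[THEN iffD2] integrable_gaussian) auto
  then have "integrable lebesgue (\<lambda>t :: real ^ 'n. exp (- (norm t)\<^sup>2 - 1))"
    by (simp add: exp_add[symmetric])
  then have "integrable (lebesgue_on T) (\<lambda>t. exp (- (norm t)\<^sup>2 - 1))"
    using assms integrable_mult_indicator[OF assms, of "\<lambda>t. exp (- (norm t)\<^sup>2 - 1)"]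
    by (simp add: integrable_restrict_space)
  then have "(\<integral>\<^sup>+ t. ennreal (exp (- (norm t)\<^sup>2 - 1)) \<partial>lebesgue_on T) < \<infinity>"
    by (simp add: integrable_iff_bounded)
  moreover have "emeasure (gauss_measure T) (space (gauss_measure T)) =
      (\<integral>\<^sup>+ t. ennreal (exp (- (norm t)\<^sup>2 - 1)) \<partial>lebesgue_on T)"
    unfolding gauss_measure_def
    by (subst emeasure_density) (auto intro!: nn_integral_cong)
  ultimately show "emeasure (gauss_measure T) (space (gauss_measure T)) \<noteq> \<infinity>" by simp
qed

lemma has_bochner_integral_gauss_measure:
  assumes f: "f \<in> borel_measurable borel"
  shows "has_bochner_integral (gauss_measure T) f c \<longleftrightarrow>
    has_bochner_integral (lebesgue_on T) (\<lambda>t. exp (- (norm t)\<^sup>2 - 1) * f t) c"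
  using integrable_density[OF borel_measurable_lebesgue_onI[OF f] measurable_weight]
    integral_density[OF borel_measurable_lebesgue_onI[OF f] measurable_weight]
  by (simp add: gauss_measure_def has_bochner_integral_iff)

lemma bounded_features_scaled_monom:
  assumes "T \<in> sets lebesgue"
  shows "bounded_features (gauss_measure T) (multi_indices (2 * k)) (scaled_monom k)"
proof -
  interpret finite_measure "gauss_measure T" by (rule finite_measure_gauss_measure[OF assms])
  show ?thesis
  proof
    show "finite (multi_indices (2 * k) :: 'a multi_index set)" by simp
    show "scaled_monom k i \<in> borel_measurable (gauss_measure T)" for i
      using borel_measurable_lebesgue_onI[OF measurable_scaled_monom]
      by (simp add: measurable_def gauss_measure_def)
    show "\<bar>scaled_monom k i x\<bar> \<le> 1" if "i \<in> multi_indices (2 * k)" for i x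
      using abs_mi_monom_le[OF that, of x] one_plus_norm_pos[of x k]
      by (simp add: scaled_monom_def)
  qed
qed

lemma AE_lebesgue_on_polynomial_nonzero:
  assumes "T \<in> sets lebesgue" "finite I" "\<exists>i\<in>I. v i \<noteq> 0"
  shows "AE t in lebesgue_on T. (\<Sum>i\<in>I. v i * mi_monom t i) \<noteq> 0"
  using AE_polynomial_nonzero[OF assms(2,3)] assms(1)
  by (simp add: AE_restrict_space_iff eventually_mono)

section \<open>The truncated moment problem\<close>

context
  fixes T :: "(real ^ 'n::finite) set" and k :: nat
  assumes T: "T \<in> sets lebesgue"
begin

interpretation bounded_features "gauss_measure T" "multi_indices (2 * k)" "scaled_monom k"
  by (rule bounded_features_scaled_monom[OF T])

lemma lincomb_scaled_monom:
  "lincomb v t = (\<Sum>i\<in>multi_indices (2 * k). v i * mi_monom t i) / (norm t ^ (2 * k) + 1)"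
  by (simp add: lincomb_def scaled_monom_def sum_divide_distrib)

lemma measurable_lincomb [measurable]: "lincomb l \<in> borel_measurable borel"
  unfolding lincomb_def[abs_def]
  by (intro borel_measurable_sum borel_measurable_times measurable_scaled_monom) auto

lemma dual_fun_eq_dual: "dual_fun T k g l = dual g l"
proof -
  have "has_bochner_integral (gauss_measure T) (\<lambda>t. exp (lincomb l t)) (partition_fun l)"
    by (simp add: has_bochner_integral_iff partition_fun_def)
  then have "has_bochner_integral (lebesgue_on T)
      (\<lambda>t. exp (- (norm t)\<^sup>2 - 1) * exp (lincomb l t)) (partition_fun l)"
    by (subst (asm) has_bochner_integral_gauss_measure) measurable
  then show ?thesis
    by (simp add: dual_fun_def dual_def lincomb_scaled_monom mult.commute[of "exp (- _ - 1)"] has_bochner_integral_iff)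
qed

lemma dual_restrict: "dual g (restrict l (multi_indices (2 * k))) = dual g l"
  by (simp add: dual_def partition_fun_def lincomb_def cong: sum.cong)

text \<open>The left-hand side is the integral of \<open>p * f\<close> for the polynomial \<open>p\<close> with coefficients \<open>v\<close>, and
  \<open>p \<le> 0 \<le> f\<close> almost everywhere on \<open>T\<close>. If it were 0, then \<open>p * f = 0\<close> almost everywhere, and since \<open>p\<close> vanishes only
  on a null set, \<open>f\<close> would have integral 0.\<close>

lemma moments_imp_separation:
  assumes f: "f \<in> L1_plus T"
    and int: "\<And>i. i \<in> multi_indices (2 * k) \<Longrightarrow> integrable (lebesgue_on T) (\<lambda>t. \<bar>mi_monom t i\<bar> * f t)"
    and mom: "\<And>i. i \<in> multi_indices (2 * k) \<Longrightarrow> (\<integral>t. mi_monom t i * f t \<partial>lebesgue_on T) = g i"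
    and f0: "(\<integral>t. f t \<partial>lebesgue_on T) \<noteq> 0"
    and v: "\<exists>i\<in>multi_indices (2 * k). v i \<noteq> 0" "AE t in gauss_measure T. lincomb v t \<le> 0"
  shows "(\<Sum>i\<in>multi_indices (2 * k). g i * v i) < 0"
proof -
  define p where "p t = (\<Sum>i\<in>multi_indices (2 * k). v i * mi_monom t i)" for t
  have f_int [measurable]: "integrable (lebesgue_on T) f" and f_nonneg: "AE t in lebesgue_on T. 0 \<le> f t"
    using f by (auto simp: L1_plus_def)
  have int': "integrable (lebesgue_on T) (\<lambda>t. mi_monom t i * f t)" if "i \<in> multi_indices (2 * k)" for i
    by (rule Bochner_Integration.integrable_bound[OF int[OF that]]) (auto simp: abs_mult)
  have pf: "p t * f t = (\<Sum>i\<in>multi_indices (2 * k). v i * (mi_monom t i * f t))" for t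
    by (simp add: p_def sum_distrib_right mult.assoc)
  have pf_int: "integrable (lebesgue_on T) (\<lambda>t. p t * f t)"
    unfolding pf by (intro Bochner_Integration.integrable_sum integrable_mult_right int')
  have gv: "(\<Sum>i\<in>multi_indices (2 * k). g i * v i) = (\<integral>t. p t * f t \<partial>lebesgue_on T)"
  proof -
    have "(\<integral>t. p t * f t \<partial>lebesgue_on T) = (\<Sum>i\<in>multi_indices (2 * k). \<integral>t. v i * (mi_monom t i * f t) \<partial>lebesgue_on T)"
      unfolding pf by (intro Bochner_Integration.integral_sum integrable_mult_right int')
    also have "\<dots> = (\<Sum>i\<in>multi_indices (2 * k). g i * v i)" by (intro sum.cong) (simp_all add: mom)
    finally show ?thesis by simp
  qed
  have p_le: "AE t in lebesgue_on T. p t \<le> 0"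
    using v(2) unfolding AE_gauss_measure
  proof eventually_elim
    fix t assume "lincomb v t \<le> 0"
    then have "p t / (norm t ^ (2 * k) + 1) \<le> 0" by (simp only: lincomb_scaled_monom p_def)
    then show "p t \<le> 0" using one_plus_norm_pos[of t k] by (simp only: pos_divide_le_eq mult_zero_left)
  qed
  have nonneg: "AE t in lebesgue_on T. 0 \<le> - (p t * f t)"
    using p_le f_nonneg by eventually_elim (simp add: mult_nonpos_nonneg)
  have "0 \<le> (\<integral>t. - (p t * f t) \<partial>lebesgue_on T)" by (rule integral_nonneg_AE[OF nonneg])
  then have "(\<Sum>i\<in>multi_indices (2 * k). g i * v i) \<le> 0" unfolding gv by simp
  moreover have "(\<Sum>i\<in>multi_indices (2 * k). g i * v i) \<noteq> 0"
  proof
    assume "(\<Sum>i\<in>multi_indices (2 * k). g i * v i) = 0"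
    then have "(\<integral>t. - (p t * f t) \<partial>lebesgue_on T) = 0" unfolding gv by simp
    then have "AE t in lebesgue_on T. - (p t * f t) = 0"
      using integral_nonneg_eq_0_iff_AE[OF integrable_minus[OF pf_int] nonneg] by simp
    moreover have "AE t in lebesgue_on T. p t \<noteq> 0"
      unfolding p_def by (rule AE_lebesgue_on_polynomial_nonzero[OF T _ v(1)]) simp
    ultimately have "AE t in lebesgue_on T. f t = 0" by eventually_elim simp
    then have "(\<integral>t. f t \<partial>lebesgue_on T) = 0" by (rule integral_eq_zero_AE)
    with f0 show False by simp
  qed
  ultimately show ?thesis by simp
qed

text \<open>As \<open>lincomb v\<close> is a polynomial up to a positive factor, it vanishes only on a null set, so
  \<open>lincomb v \<le> 0\<close> almost everywhere improves to strict inequality.\<close>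

lemma bounded_dual_fun_imp_separation:
  assumes bdd: "bdd_above (dual_fun T k g ` param_space k)" and i0: "i0 \<in> multi_indices (2 * k)" "g i0 \<noteq> 0"
    and v: "\<exists>i\<in>multi_indices (2 * k). v i \<noteq> 0" "AE t in gauss_measure T. lincomb v t \<le> 0"
  shows "(\<Sum>i\<in>multi_indices (2 * k). g i * v i) < 0"
proof -
  obtain K where K: "\<And>l. l \<in> param_space k \<Longrightarrow> dual g l \<le> K"
    using bdd by (auto simp: bdd_above_def dual_fun_eq_dual)
  have "dual g l \<le> K" for l
    using K[of "restrict l (multi_indices (2 * k))"] by (simp add: dual_restrict param_space_def)
  moreover have "AE t in lebesgue_on T. (\<Sum>i\<in>multi_indices (2 * k). v i * mi_monom t i) \<noteq> 0"
    by (rule AE_lebesgue_on_polynomial_nonzero[OF T _ v(1)]) simp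
  then have "AE t in gauss_measure T. lincomb v t \<noteq> 0"
    unfolding AE_gauss_measure
  proof eventually_elim
    fix t assume "(\<Sum>i\<in>multi_indices (2 * k). v i * mi_monom t i) \<noteq> 0"
    then show "lincomb v t \<noteq> 0" using one_plus_norm_pos[of t k] by (simp add: lincomb_scaled_monom)
  qed
  with v(2) have "AE t in gauss_measure T. lincomb v t < 0" by eventually_elim simp
  ultimately show ?thesis using bounded_dual_imp_separation i0 by blast
qed

text \<open>Multiplying the feature \<open>scaled_monom k i\<close> by the density of \<open>gauss_measure T\<close> and the exponential
  gives \<open>t\<^sup>i * opt_density k l t\<close>: the denominator moves from the monomial to the density. So the
  moment equations at a maximum of the dual function are those of \<open>opt_density\<close>.\<close>

lemma separation_imp_opt_density:
  assumes "\<And>v. \<exists>i\<in>multi_indices (2 * k). v i \<noteq> 0 \<Longrightarrow> AE t in gauss_measure T. lincomb v t \<le> 0 \<Longrightarrow> (\<Sum>i\<in>multi_indices (2 * k). g i * v i) < 0"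
  shows "\<exists>l\<in>param_space k.
      (\<forall>l'\<in>param_space k. dual_fun T k g l' \<le> dual_fun T k g l) \<and>
      (\<forall>i\<in>multi_indices (2 * k). has_bochner_integral (lebesgue_on T) (\<lambda>t. mi_monom t i * opt_density k l t) (g i))"
proof -
  obtain l0 where "\<And>l'. dual g l' \<le> dual g l0" using dual_attains_max[OF assms] by blast
  then have max: "dual g l' \<le> dual g (restrict l0 (multi_indices (2 * k)))" for l' by (simp add: dual_restrict)
  let ?l = "restrict l0 (multi_indices (2 * k))"
  have "has_bochner_integral (lebesgue_on T) (\<lambda>t. mi_monom t i * opt_density k ?l t) (g i)"
    if i: "i \<in> multi_indices (2 * k)" for i
  proof -
    have "has_bochner_integral (gauss_measure T) (\<lambda>t. scaled_monom k i t * exp (lincomb ?l t)) (g i)"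
      by (rule dual_max_imp_moments[OF max i])
    then have "has_bochner_integral (lebesgue_on T)
        (\<lambda>t. exp (- (norm t)\<^sup>2 - 1) * (scaled_monom k i t * exp (lincomb ?l t))) (g i)"
      by (subst (asm) has_bochner_integral_gauss_measure)
         (intro borel_measurable_times measurable_scaled_monom; measurable)+
    moreover have "exp (- (norm t)\<^sup>2 - 1) * (scaled_monom k i t * exp (lincomb ?l t))
        = mi_monom t i * opt_density k ?l t" for t
      by (simp add: opt_density_def scaled_monom_def lincomb_def)
    ultimately show ?thesis by simp
  qed
  then show ?thesis
    using max by (intro bexI[of _ ?l]) (auto simp: dual_fun_eq_dual param_space_def)
qed

end

theorem corollary7:
  fixes T :: "(real ^ 'n::finite) set"
    and k :: nat
    and g :: "'n multi_index \<Rightarrow> real"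
  assumes "closed T"
    and "g (\<lambda>_. 0) = 1"
  shows "((\<exists>f\<in>L1_plus T.
             (\<forall>i\<in>multi_indices (2 * k). integrable (lebesgue_on T) (\<lambda>t. \<bar>mi_monom t i\<bar> * f t)) \<and>
             (\<forall>i\<in>multi_indices (2 * k). (\<integral>t. mi_monom t i * f t \<partial>lebesgue_on T) = g i))
          \<longleftrightarrow> bdd_above (dual_fun T k g ` param_space k))
       \<and> (bdd_above (dual_fun T k g ` param_space k) \<longrightarrow>
            (\<exists>l\<in>param_space k.
               (\<forall>l'\<in>param_space k. dual_fun T k g l' \<le> dual_fun T k g l) \<and>
               (\<forall>i\<in>multi_indices (2 * k).
                  has_bochner_integral (lebesgue_on T) (\<lambda>t. mi_monom t i * opt_density k l t) (g i))))"
proof (intro conjI iffI impI)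
  let ?I = "multi_indices (2 * k) :: 'n multi_index set"
  have T: "T \<in> sets lebesgue" using assms(1) by simp
  have zero: "(\<lambda>_. 0) \<in> ?I" by (simp add: multi_indices_def mi_degree_def)
  {
    assume bdd: "bdd_above (dual_fun T k g ` param_space k)"
    show max: "\<exists>l\<in>param_space k.
        (\<forall>l'\<in>param_space k. dual_fun T k g l' \<le> dual_fun T k g l) \<and>
        (\<forall>i\<in>?I. has_bochner_integral (lebesgue_on T) (\<lambda>t. mi_monom t i * opt_density k l t) (g i))"
      using bounded_dual_fun_imp_separation[OF T bdd zero] assms(2)
      by (intro separation_imp_opt_density[OF T]) auto
    then obtain l where mom: "\<And>i. i \<in> ?I \<Longrightarrow>
        has_bochner_integral (lebesgue_on T) (\<lambda>t. mi_monom t i * opt_density k l t) (g i)"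
      by blast
    have nonneg: "0 \<le> opt_density k l t" for t :: "real ^ 'n"
      using one_plus_norm_pos[of t k] by (simp add: opt_density_def)
    show "\<exists>f\<in>L1_plus T.
        (\<forall>i\<in>?I. integrable (lebesgue_on T) (\<lambda>t. \<bar>mi_monom t i\<bar> * f t)) \<and>
        (\<forall>i\<in>?I. (\<integral>t. mi_monom t i * f t \<partial>lebesgue_on T) = g i)"
    proof (intro bexI[of _ "opt_density k l"] conjI ballI)
      fix i assume i: "i \<in> ?I"
      show "(\<integral>t. mi_monom t i * opt_density k l t \<partial>lebesgue_on T) = g i"
        using mom[OF i] by (rule has_bochner_integral_integral_eq)
      have "integrable (lebesgue_on T) (\<lambda>t. \<bar>mi_monom t i * opt_density k l t\<bar>)"
        using mom[OF i] by (intro integrable_abs) (rule integrable.intros)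
      then show "integrable (lebesgue_on T) (\<lambda>t. \<bar>mi_monom t i\<bar> * opt_density k l t)"
        by (simp add: abs_mult nonneg)
    next
      have "integrable (lebesgue_on T) (opt_density k l)"
        using mom[OF zero] by (simp add: mi_monom_def has_bochner_integral_iff)
      then show "opt_density k l \<in> L1_plus T" by (simp add: L1_plus_def nonneg)
    qed
  }
  assume "\<exists>f\<in>L1_plus T.
      (\<forall>i\<in>?I. integrable (lebesgue_on T) (\<lambda>t. \<bar>mi_monom t i\<bar> * f t)) \<and>
      (\<forall>i\<in>?I. (\<integral>t. mi_monom t i * f t \<partial>lebesgue_on T) = g i)"
  then obtain f where f: "f \<in> L1_plus T"
      "\<And>i. i \<in> ?I \<Longrightarrow> integrable (lebesgue_on T) (\<lambda>t. \<bar>mi_monom t i\<bar> * f t)"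
      "\<And>i. i \<in> ?I \<Longrightarrow> (\<integral>t. mi_monom t i * f t \<partial>lebesgue_on T) = g i"
    by blast
  have "(\<integral>t. f t \<partial>lebesgue_on T) \<noteq> 0"
    using f(3)[OF zero] assms(2) by (simp add: mi_monom_def)
  then have "\<exists>l\<in>param_space k.
      (\<forall>l'\<in>param_space k. dual_fun T k g l' \<le> dual_fun T k g l) \<and>
      (\<forall>i\<in>?I. has_bochner_integral (lebesgue_on T) (\<lambda>t. mi_monom t i * opt_density k l t) (g i))"
    using moments_imp_separation[OF T f] by (intro separation_imp_opt_density[OF T]) auto
  then show "bdd_above (dual_fun T k g ` param_space k)"
    by (auto simp: bdd_above_def)
qed

end
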